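(* The following randomized online algorithm for the discrete data-center optimization problem is 2-competitive against an oblivious adversary, i.e. for every instance its expected cost is at most twice the cost of an optimal schedule. At each time $t$, compute $\bar x_t\in[0,m]$ by running, on the continuous extension of the instance, the deterministic 2-competitive online algorithm of Bansal et al. for the continuous problem (set $\bar x_0=0$, $x_0=0$). Let $\bar x'_{t-1}=\max\{\lfloor\bar x_t\rfloor,\min\{\lceil\bar x_t\rceil,\bar x_{t-1}\}\}$ and $\phi_{t}=\bar x'_{t-1}-\lfloor\bar x_t\rfloor$. If $\bar x_t$ is an integer, set $x_t=\bar x_t$. Otherwise: if $\bar x_{t-1}\le\bar x_t$, then set $x_t=\lceil\bar x_t\rceil$ if $x_{t-1}=\lceil\bar x_t\rceil$, and otherwise set $x_t=\lceil\bar x_t\rceil$ with probability $p^\uparrow_t=\frac{\bar x_t-\bar x'_{t-1}}{1-\phi_t}$ and $x_t=\lfloor\bar x_t\rfloor$ with probability $1-p^\uparrow_t$; if $\bar x_{t-1}>\bar x_t$, then set $x_t=\lfloor\bar x_t\rfloor$ if $x_{t-1}=\lfloor\bar x_t\rfloor$, and otherwise set $x_t=\lfloor\bar x_t\rfloor$ with probability $p^\downarrow_t=\frac{\bar x'_{t-1}-\bar x_t}{\phi_t}$ and $x_t=\lceil\bar x_t\rceil$ with probability $1-p^\downarrow_t$.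
   Context: Discrete data-center optimization problem: given $T,m\in\mathbb{N}$, $\beta>0$ and convex functions $f_1,\dots,f_T:\{0,\dots,m\}\to\mathbb{R}_{\ge0}$ (convex meaning $f_t(x+1)-f_t(x)$ nondecreasing), a schedule $X=(x_1,\dots,x_T)\in\{0,\dots,m\}^T$ with $x_0=0$ has cost $\sum_{t=1}^T f_t(x_t)+\beta\sum_{t=1}^T(x_t-x_{t-1})^+$, $(y)^+=\max(0,y)$. Online: $f_t$ is revealed at time $t$ and $x_t$ is chosen then, irrevocably. Oblivious adversary: the instance is fixed in advance, independent of the algorithm's random choices. The continuous extension allows $x_t\in[0,m]$ and uses $\bar f_t$, equal to $f_t$ at integers and linearly interpolated between consecutive integers. Bansal et al. (N. Bansal, A. Gupta, R. Krishnaswamy, K. Pruhs, K. Schewior, C. Stein, "A 2-competitive algorithm for online convex optimization with switching costs", APPROX 2015) give a deterministic online algorithm for the continuous problem whose cost is at most twice the optimal continuous cost. *)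

theory Defs
  imports "HOL-Probability.Probability"
begin

text \<open>
  Time steps are \<open>1, \<dots>, T\<close>; \<open>f t\<close> is the cost function of step \<open>t\<close>, and only its values
  on \<open>{0..m}\<close> matter.  A schedule is a function \<open>X\<close> on time with \<open>X 0 = 0\<close>;
  its values after \<open>T\<close> are irrelevant.
\<close>

definition dc_instance :: "nat \<Rightarrow> real \<Rightarrow> nat \<Rightarrow> (nat \<Rightarrow> nat \<Rightarrow> real) \<Rightarrow> bool" where
  "dc_instance m \<beta> T f \<longleftrightarrow> \<beta> > 0 \<and>
     (\<forall>t\<in>{1..T}. (\<forall>x\<le>m. f t x \<ge> 0) \<and> mono_on {..<m} (\<lambda>x. f t (x + 1) - f t x))"

definition dc_schedules :: "nat \<Rightarrow> nat \<Rightarrow> (nat \<Rightarrow> nat) set" where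
  "dc_schedules m T = {X. X 0 = 0 \<and> (\<forall>t\<in>{1..T}. X t \<le> m)}"

definition dc_cost :: "real \<Rightarrow> nat \<Rightarrow> (nat \<Rightarrow> nat \<Rightarrow> real) \<Rightarrow> (nat \<Rightarrow> nat) \<Rightarrow> real" where
  "dc_cost \<beta> T f X =
     (\<Sum>t=1..T. f t (X t)) + \<beta> * (\<Sum>t=1..T. max 0 (real (X t) - real (X (t - 1))))"

definition dc_opt :: "nat \<Rightarrow> real \<Rightarrow> nat \<Rightarrow> (nat \<Rightarrow> nat \<Rightarrow> real) \<Rightarrow> real" where
  "dc_opt m \<beta> T f = (INF X\<in>dc_schedules m T. dc_cost \<beta> T f X)"


text \<open>
  The interpolation is undefined outside \<open>[0,m]\<close>, so that an algorithm reading it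
  learns nothing but the values of \<open>f\<close> on \<open>{0..m}\<close>.
\<close>

definition interpolate :: "nat \<Rightarrow> (nat \<Rightarrow> real) \<Rightarrow> real \<Rightarrow> real" where
  "interpolate m f = (\<lambda>x\<in>{0..real m}.
     f (nat \<lfloor>x\<rfloor>) + (x - of_int \<lfloor>x\<rfloor>) * (f (nat \<lceil>x\<rceil>) - f (nat \<lfloor>x\<rfloor>)))"

definition cont_schedules :: "nat \<Rightarrow> nat \<Rightarrow> (nat \<Rightarrow> real) set" where
  "cont_schedules m T = {X. X 0 = 0 \<and> (\<forall>t\<in>{1..T}. X t \<in> {0..real m})}"

definition cont_cost :: "real \<Rightarrow> nat \<Rightarrow> (nat \<Rightarrow> real \<Rightarrow> real) \<Rightarrow> (nat \<Rightarrow> real) \<Rightarrow> real" where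
  "cont_cost \<beta> T g X =
     (\<Sum>t=1..T. g t (X t)) + \<beta> * (\<Sum>t=1..T. max 0 (X t - X (t - 1)))"

definition cont_opt :: "nat \<Rightarrow> real \<Rightarrow> nat \<Rightarrow> (nat \<Rightarrow> real \<Rightarrow> real) \<Rightarrow> real" where
  "cont_opt m \<beta> T g = (INF X\<in>cont_schedules m T. cont_cost \<beta> T g X)"


text \<open>
  A deterministic online algorithm for the continuous problem maps \<open>m\<close>, \<open>\<beta>\<close> and the
  functions revealed up to time \<open>t\<close>, as the list of length \<open>t\<close>, to the state at time \<open>t\<close>.
  It knows neither future functions nor the horizon \<open>T\<close>.
\<close>

type_synonym cont_online_alg = "nat \<Rightarrow> real \<Rightarrow> (real \<Rightarrow> real) list \<Rightarrow> real"

definition online_run ::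
    "cont_online_alg \<Rightarrow> nat \<Rightarrow> real \<Rightarrow> (nat \<Rightarrow> real \<Rightarrow> real) \<Rightarrow> nat \<Rightarrow> real" where
  "online_run A m \<beta> g t = (if t = 0 then 0 else A m \<beta> (map g [1..<Suc t]))"

definition cont_competitive :: "real \<Rightarrow> cont_online_alg \<Rightarrow> bool" where
  "cont_competitive c A \<longleftrightarrow> (\<forall>m \<beta> T f. dc_instance m \<beta> T f \<longrightarrow>
     (let g = (\<lambda>t. interpolate m (f t)); X = online_run A m \<beta> g
      in X \<in> cont_schedules m T \<and> cont_cost \<beta> T g X \<le> c * cont_opt m \<beta> T g))"


text \<open>
  The distribution of \<open>x\<^sub>t\<close> given the fractional states \<open>xp\<close>, \<open>xb\<close> at times
  \<open>t - 1\<close>, \<open>t\<close> and the integral state \<open>x\<close> at time \<open>t - 1\<close>.  In the branches where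
  they are used, both Bernoulli parameters lie in \<open>[0,1]\<close> and have nonzero denominators.
\<close>

definition rounding_step :: "real \<Rightarrow> real \<Rightarrow> nat \<Rightarrow> nat pmf" where
  "rounding_step xp xb x =
     (let lo = nat \<lfloor>xb\<rfloor>; hi = nat \<lceil>xb\<rceil>;
          xp' = max (of_int \<lfloor>xb\<rfloor>) (min (of_int \<lceil>xb\<rceil>) xp);
          \<phi> = xp' - of_int \<lfloor>xb\<rfloor>
      in if xb \<in> \<int> then return_pmf lo
         else if xp \<le> xb then
           (if x = hi then return_pmf hi
            else map_pmf (\<lambda>b. if b then hi else lo) (bernoulli_pmf ((xb - xp') / (1 - \<phi>))))
         else
           (if x = lo then return_pmf lo
            else map_pmf (\<lambda>b. if b then lo else hi) (bernoulli_pmf ((xp' - xb) / \<phi>))))"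

text \<open>
  The joint distribution of the schedule up to a given time; the coins of different steps
  are independent.
\<close>

primrec rounded_schedule :: "(nat \<Rightarrow> real) \<Rightarrow> nat \<Rightarrow> (nat \<Rightarrow> nat) pmf" where
  "rounded_schedule Xb 0 = return_pmf (\<lambda>_. 0)"
| "rounded_schedule Xb (Suc t) =
     bind_pmf (rounded_schedule Xb t)
       (\<lambda>X. map_pmf (\<lambda>x. X(Suc t := x)) (rounding_step (Xb t) (Xb (Suc t)) (X t)))"

definition randomized_rounding ::
    "cont_online_alg \<Rightarrow> nat \<Rightarrow> real \<Rightarrow> (nat \<Rightarrow> nat \<Rightarrow> real) \<Rightarrow> nat \<Rightarrow> (nat \<Rightarrow> nat) pmf" where
  "randomized_rounding A m \<beta> f T =
     rounded_schedule (online_run A m \<beta> (\<lambda>t. interpolate m (f t))) T"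

text \<open>
  Competitiveness against an oblivious adversary: the instance is fixed before the
  expectation is taken.  The first conjunct says that the algorithm only outputs schedules
  of the instance.
\<close>

definition oblivious_competitive ::
    "real \<Rightarrow> (nat \<Rightarrow> real \<Rightarrow> (nat \<Rightarrow> nat \<Rightarrow> real) \<Rightarrow> nat \<Rightarrow> (nat \<Rightarrow> nat) pmf) \<Rightarrow> bool" where
  "oblivious_competitive c R \<longleftrightarrow> (\<forall>m \<beta> T f. dc_instance m \<beta> T f \<longrightarrow>
     set_pmf (R m \<beta> f T) \<subseteq> dc_schedules m T \<and>
     measure_pmf.expectation (R m \<beta> f T) (dc_cost \<beta> T f) \<le> c * dc_opt m \<beta> T f)"

end

theory Submission
  imports Defs
begin

text \<open>
  The rounding keeps the invariant that \<open>x\<^sub>t\<close> is one of the two integers next to the fractional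
  state and has the fractional state as its mean.  The expected operating cost is therefore exactly
  the interpolated one.  Each step moves the integral state, surely, in the same direction as the
  fractional state, so the expected switching cost is the positive part of the difference of the
  means.  Hence the expected cost of the rounded schedule equals the cost of the fractional one,
  and the continuous optimum is at most the discrete one.
\<close>

section \<open>Integers next to a real state\<close>

text \<open>A set rather than a pair, so that integer states, where it collapses to one point, fit
  the same support invariant. Truncation by \<open>nat\<close> is harmless at the nonnegative states
  where it is applied.\<close>

definition roundings :: "real \<Rightarrow> nat set" where
  "roundings y = {nat \<lfloor>y\<rfloor>, nat \<lceil>y\<rceil>}"

lemma finite_roundings [simp]: "finite (roundings y)"
  by (simp add: roundings_def)

lemma roundings_Ints: "y \<in> \<int> \<Longrightarrow> roundings y = {nat \<lfloor>y\<rfloor>}"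
  by (auto simp: roundings_def elim!: Ints_cases)

text \<open>The bound \<open>m\<close> is an integer, so even rounding up does not pass it.\<close>

lemma roundings_le: "\<lbrakk>x \<in> roundings y; y \<le> real m\<rbrakk> \<Longrightarrow> x \<le> m"
  unfolding roundings_def by (auto simp: nat_le_iff ceiling_le_iff) linarith

lemma ceiling_not_Int: "y \<notin> \<int> \<Longrightarrow> \<lceil>y\<rceil> = \<lfloor>y\<rfloor> + 1" for y :: real
  by (metis Ints_of_int ceiling_altdef)

section \<open>Expectations under finitely supported distributions\<close>

lemma expectation_bernoulli_branch:
  fixes h :: "'a \<Rightarrow> real"
  assumes "0 \<le> q" "q \<le> 1"
  shows "measure_pmf.expectation (map_pmf (\<lambda>b. if b then u else v) (bernoulli_pmf q)) h
       = h u * q + h v * (1 - q)"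
  using assms by simp

lemma expectation_bind_finite:
  fixes h :: "'b \<Rightarrow> real"
  assumes "finite (set_pmf p)" "\<And>x. x \<in> set_pmf p \<Longrightarrow> finite (set_pmf (k x))"
  shows "measure_pmf.expectation (bind_pmf p k) h
       = measure_pmf.expectation p (\<lambda>x. measure_pmf.expectation (k x) h)"
  using assms
  by (subst pmf_expectation_bind[of "set_pmf p"]) (auto simp: integral_measure_pmf[of "set_pmf p"])

lemma expectation_pmf_cong:
  fixes g h :: "'a \<Rightarrow> real"
  assumes "\<And>x. x \<in> set_pmf p \<Longrightarrow> g x = h x"
  shows "measure_pmf.expectation p g = measure_pmf.expectation p h"
  using assms by (intro integral_cong_AE) (auto simp: AE_measure_pmf_iff)

lemma expectation_affine:
  fixes g :: "'a \<Rightarrow> real"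
  assumes "finite (set_pmf p)"
  shows "measure_pmf.expectation p (\<lambda>x. c + d * g x) = c + d * measure_pmf.expectation p g"
  using integrable_measure_pmf_finite[OF assms, of g] by simp

section \<open>One rounding step: support, direction and mean\<close>

lemma set_rounding_step: "set_pmf (rounding_step xp xb x) \<subseteq> roundings xb"
  by (auto simp: rounding_step_def Let_def roundings_def split: if_splits)

lemma finite_rounding_step: "finite (set_pmf (rounding_step xp xb x))"
  using set_rounding_step finite_roundings by (rule finite_subset)

text \<open>For fractional \<open>xb\<close>, the only neighbour of \<open>xp\<close> above the
  floor of \<open>xb\<close> is the ceiling of \<open>xb\<close>, and there the step stays put. Any
  other \<open>x\<close> lies at or below both possible outcomes.\<close>

lemma rounding_step_up:
  assumes "xp \<le> xb" "x \<in> roundings xp" "y \<in> set_pmf (rounding_step xp xb x)"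
  shows "x \<le> y"
proof (cases "xb \<in> \<int>")
  case True
  then obtain k where k: "xb = of_int k" by (auto elim: Ints_cases)
  have "y = nat k" using assms(3) k by (simp add: rounding_step_def)
  moreover have "\<lceil>xp\<rceil> \<le> k" "\<lfloor>xp\<rfloor> \<le> k" using assms(1) k by linarith+
  ultimately show ?thesis using assms(2) nat_mono unfolding roundings_def by blast
next
  case False
  show ?thesis
  proof (cases "x = nat \<lceil>xb\<rceil>")
    case True
    then show ?thesis using assms False by (simp add: rounding_step_def)
  next
    case ne: False
    have "\<lceil>xb\<rceil> = \<lfloor>xb\<rfloor> + 1" using False by (rule ceiling_not_Int)
    moreover have "\<lceil>xp\<rceil> \<le> \<lceil>xb\<rceil>" "\<lfloor>xp\<rfloor> \<le> \<lfloor>xb\<rfloor>"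
      using assms(1) by (simp_all add: ceiling_mono floor_mono)
    ultimately have "x \<le> nat \<lfloor>xb\<rfloor>" using ne assms(2)
      unfolding roundings_def by (elim insertE emptyE; linarith)
    moreover have "nat \<lfloor>xb\<rfloor> \<le> y"
      using set_rounding_step[of xp xb x] assms(3) \<open>\<lceil>xb\<rceil> = \<lfloor>xb\<rfloor> + 1\<close>
      by (auto simp: roundings_def)
    ultimately show ?thesis by (rule le_trans)
  qed
qed

text \<open>Mirror image of \<open>rounding_step_up\<close>: a state already at the floor of
  \<open>xb\<close> is kept, and every other neighbour of \<open>xp\<close> is at least the ceiling
  of \<open>xb\<close>.\<close>

lemma rounding_step_down:
  assumes "xb < xp" "x \<in> roundings xp" "y \<in> set_pmf (rounding_step xp xb x)"
  shows "y \<le> x"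
proof (cases "xb \<in> \<int>")
  case True
  then obtain k where k: "xb = of_int k" by (auto elim: Ints_cases)
  have "y = nat k" using assms(3) k by (simp add: rounding_step_def)
  moreover have "k \<le> \<lceil>xp\<rceil>" "k \<le> \<lfloor>xp\<rfloor>" using assms(1) k by linarith+
  ultimately show ?thesis using assms(2) nat_mono unfolding roundings_def by blast
next
  case False
  show ?thesis
  proof (cases "x = nat \<lfloor>xb\<rfloor>")
    case True
    then show ?thesis using assms False by (simp add: rounding_step_def)
  next
    case ne: False
    have "\<lceil>xb\<rceil> = \<lfloor>xb\<rfloor> + 1" using False by (rule ceiling_not_Int)
    moreover have "\<lceil>xb\<rceil> \<le> \<lceil>xp\<rceil>" "\<lfloor>xb\<rfloor> \<le> \<lfloor>xp\<rfloor>"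
      using assms(1) by (simp_all add: ceiling_mono floor_mono)
    ultimately have "nat \<lceil>xb\<rceil> \<le> x" using ne assms(2)
      unfolding roundings_def by (elim insertE emptyE; linarith)
    moreover have "y \<le> nat \<lceil>xb\<rceil>"
      using set_rounding_step[of xp xb x] assms(3) \<open>\<lceil>xb\<rceil> = \<lfloor>xb\<rfloor> + 1\<close>
      by (auto simp: roundings_def)
    ultimately show ?thesis by (rule le_trans[rotated])
  qed
qed

text \<open>
  The conditional mean is affine in the previous integral state, so only the mean of that state
  matters for the mean of the next one.
\<close>

lemma rounding_step_mean:
  assumes "0 \<le> xp" "0 \<le> xb"
  obtains c d where "c + d * xp = xb"
    "\<And>x. x \<in> roundings xp \<Longrightarrow> measure_pmf.expectation (rounding_step xp xb x) real = c + d * real x"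
proof (cases "xb \<in> \<int>")
  case True
  then obtain k where "xb = of_int k" by (auto elim: Ints_cases)
  \<comment> \<open>The outcome is deterministic, so the conditional mean is the constant
    \<open>xb\<close>.\<close>
  with assms show ?thesis
    by (intro that[of xb 0]) (auto simp: rounding_step_def)
next
  case False
  define k where "k = nat \<lfloor>xb\<rfloor>"
  have fl: "\<lfloor>xb\<rfloor> = int k" using assms by (simp add: k_def)
  have ce: "\<lceil>xb\<rceil> = int k + 1" using ceiling_not_Int[OF False] fl by simp
  have "xb \<noteq> real k" using False by auto
  then have lo: "real k < xb" and hi: "xb < real k + 1" using fl by linarith+
  have hi_nat: "nat (int k + 1) = Suc k" by simp
  have step: "rounding_step xp xb x =
     (if xp \<le> xb then
        (if x = Suc k then return_pmf (Suc k)
         else map_pmf (\<lambda>b. if b then Suc k else k)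
           (bernoulli_pmf ((xb - max k (min (real k + 1) xp)) / (1 - (max k (min (real k + 1) xp) - k)))))
      else
        (if x = k then return_pmf k
         else map_pmf (\<lambda>b. if b then k else Suc k)
           (bernoulli_pmf ((max k (min (real k + 1) xp) - xb) / (max k (min (real k + 1) xp) - k)))))" for x
    using False by (simp add: rounding_step_def Let_def fl ce hi_nat)
  \<comment> \<open>The clamped previous state is \<open>k\<close> in the first case,
    \<open>xp\<close> in the middle two and \<open>k + 1\<close> in the last. In the outer cases
    \<open>x\<close> is never the state that would be kept, so the step does not depend on
    \<open>x\<close> and has mean \<open>xb\<close>.\<close>
  consider "xp \<le> k" | "k < xp" "xp \<le> xb" | "xb < xp" "xp < k + 1" | "real k + 1 \<le> xp" by linarith
  then show ?thesis
  proof cases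
    case 1
    have "x \<le> k" if "x \<in> roundings xp" for x using roundings_le[OF that 1] .
    moreover have "max (real k) (min (real k + 1) xp) = real k" "xp \<le> xb"
      using 1 lo hi by auto
    ultimately have "rounding_step xp xb x
        = map_pmf (\<lambda>b. if b then Suc k else k) (bernoulli_pmf (xb - k))"
      if "x \<in> roundings xp" for x
      using that by (fastforce simp: step algebra_simps)
    then show ?thesis
      using lo hi
      by (intro that[of xb 0])
        (auto simp: expectation_bernoulli_branch algebra_simps simp del: integral_map_pmf)
  next
    case 2
    define q where "q = (xb - xp) / (k + 1 - xp)"
    have q: "0 \<le> q" "q \<le> 1" "q * (k + 1 - xp) = xb - xp" using 2 hi by (auto simp: q_def)
    have "\<lfloor>xp\<rfloor> = int k" "\<lceil>xp\<rceil> = int k + 1" using 2 hi by linarith+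
    then have r: "roundings xp = {k, Suc k}" by (simp add: roundings_def hi_nat)
    have s: "rounding_step xp xb x = (if x = Suc k then return_pmf (Suc k)
         else map_pmf (\<lambda>b. if b then Suc k else k) (bernoulli_pmf q))" for x
      using 2 hi by (simp add: step q_def max_def min_def algebra_simps)
    \<comment> \<open>The conditional mean is \<open>k + q\<close> from \<open>k\<close> and
      \<open>k + 1\<close> from \<open>k + 1\<close>. The line through these two points is
      \<open>(1 - q) * x + q * (k + 1)\<close>.\<close>
    show ?thesis
    proof (rule that[of "(k + 1) * q" "1 - q"])
      show "(k + 1) * q + (1 - q) * xp = xb" using q(3) by (simp add: algebra_simps)
    qed (use q in \<open>auto simp: r s algebra_simps expectation_bernoulli_branch simp del: integral_map_pmf\<close>)
  next
    case 3
    define q where "q = (xp - xb) / (xp - k)"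
    have q: "0 \<le> q" "q \<le> 1" "q * (xp - k) = xp - xb" using 3 lo by (auto simp: q_def)
    have "\<lfloor>xp\<rfloor> = int k" "\<lceil>xp\<rceil> = int k + 1" using 3 lo by linarith+
    then have r: "roundings xp = {k, Suc k}" by (simp add: roundings_def hi_nat)
    have s: "rounding_step xp xb x = (if x = k then return_pmf k
         else map_pmf (\<lambda>b. if b then k else Suc k) (bernoulli_pmf q))" for x
      using 3 lo by (simp add: step q_def max_def min_def algebra_simps)
    \<comment> \<open>Here the means are \<open>k\<close> from \<open>k\<close> and
      \<open>k + 1 - q\<close> from \<open>k + 1\<close>, which gives the line
      \<open>(1 - q) * x + q * k\<close>.\<close>
    show ?thesis
    proof (rule that[of "k * q" "1 - q"])
      show "k * q + (1 - q) * xp = xb" using q(3) by (simp add: algebra_simps)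
    qed (use q in \<open>auto simp: r s algebra_simps expectation_bernoulli_branch simp del: integral_map_pmf\<close>)
  next
    case 4
    have "\<lfloor>xp\<rfloor> \<ge> int k + 1" "\<lceil>xp\<rceil> \<ge> int k + 1" using 4 by linarith+
    then have "x \<noteq> k" if "x \<in> roundings xp" for x
      using that unfolding roundings_def by (elim insertE emptyE; linarith)
    moreover have "max (real k) (min (real k + 1) xp) = real k + 1" "\<not> xp \<le> xb"
      using 4 lo hi by auto
    ultimately have "rounding_step xp xb x
        = map_pmf (\<lambda>b. if b then k else Suc k) (bernoulli_pmf (real k + 1 - xb))"
      if "x \<in> roundings xp" for x
      using that by (auto simp: step algebra_simps)
    then show ?thesis
      using lo hi
      by (intro that[of xb 0])
        (auto simp: expectation_bernoulli_branch algebra_simps simp del: integral_map_pmf)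
  qed
qed

section \<open>Expectation of a function of a rounded state\<close>

text \<open>On at most two adjacent integers every function coincides with an affine one, so its
  expectation depends on the mean alone. The value of that line at \<open>y\<close> is the linear
  interpolation.\<close>

lemma expectation_roundings:
  assumes "set_pmf p \<subseteq> roundings y" "measure_pmf.expectation p real = y" "y \<in> {0..real m}"
  shows "measure_pmf.expectation p h = interpolate m h y"
proof -
  let ?l = "nat \<lfloor>y\<rfloor>" and ?u = "nat \<lceil>y\<rceil>"
  have lin: "h x = (h ?l - real ?l * (h ?u - h ?l)) + (h ?u - h ?l) * real x"
    if "x \<in> roundings y" for x
  proof (cases "y \<in> \<int>")
    case True
    then show ?thesis using that by (auto simp: roundings_Ints elim!: Ints_cases)
  next
    case False
    then have "\<lceil>y\<rceil> = \<lfloor>y\<rfloor> + 1" by (rule ceiling_not_Int)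
    then have "?u = Suc ?l" using assms(3) by (simp add: nat_add_distrib)
    then show ?thesis using that unfolding roundings_def by (auto simp: algebra_simps)
  qed
  have fin: "finite (set_pmf p)" using assms(1) finite_roundings by (rule finite_subset)
  have "measure_pmf.expectation p h
      = measure_pmf.expectation p (\<lambda>x. (h ?l - real ?l * (h ?u - h ?l)) + (h ?u - h ?l) * real x)"
    using assms(1) lin by (intro expectation_pmf_cong) blast
  also have "\<dots> = (h ?l - real ?l * (h ?u - h ?l)) + (h ?u - h ?l) * y"
    by (simp only: expectation_affine[OF fin] assms(2))
  also have "\<dots> = interpolate m h y"
    using assms(3) by (simp add: interpolate_def algebra_simps)
  finally show ?thesis .
qed

section \<open>The law of the rounded schedule\<close>

lemma finite_rounded_schedule: "finite (set_pmf (rounded_schedule Xb t))"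
  by (induction t) (auto intro: finite_rounding_step)

lemma rounded_schedule_roundings:
  assumes "Xb 0 = 0" "X \<in> set_pmf (rounded_schedule Xb t)" "s \<le> t"
  shows "X s \<in> roundings (Xb s)"
  using assms(2,3)
proof (induction t arbitrary: X)
  case 0
  then show ?case using assms(1) by (simp add: roundings_def)
next
  case (Suc t)
  then show ?case using set_rounding_step by (fastforce simp: le_Suc_eq)
qed

lemma expectation_rounded_schedule_Suc:
  fixes h :: "(nat \<Rightarrow> nat) \<Rightarrow> real"
  shows "measure_pmf.expectation (rounded_schedule Xb (Suc t)) h
       = measure_pmf.expectation (rounded_schedule Xb t) (\<lambda>X.
           measure_pmf.expectation (rounding_step (Xb t) (Xb (Suc t)) (X t)) (\<lambda>x. h (X(Suc t := x))))"
  by (simp add: expectation_bind_finite finite_rounded_schedule finite_rounding_step)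

text \<open>The conditional mean of the new state is \<open>c + d * X t\<close>, so by linearity and
  induction its mean is \<open>c + d * Xb t\<close>, which is \<open>Xb (Suc t)\<close>.\<close>

lemma rounded_schedule_mean:
  assumes "Xb 0 = 0" "\<And>s. s \<in> {1..t} \<Longrightarrow> 0 \<le> Xb s"
  shows "measure_pmf.expectation (rounded_schedule Xb t) (\<lambda>X. real (X t)) = Xb t"
  using assms(2)
proof (induction t)
  case 0
  then show ?case using assms(1) by simp
next
  case (Suc t)
  have IH: "measure_pmf.expectation (rounded_schedule Xb t) (\<lambda>X. real (X t)) = Xb t"
    using Suc by simp
  have "0 \<le> Xb t" "0 \<le> Xb (Suc t)" using Suc.prems assms(1) by (cases t; simp)+
  then obtain c d where cd: "c + d * Xb t = Xb (Suc t)"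
    "\<And>x. x \<in> roundings (Xb t) \<Longrightarrow>
      measure_pmf.expectation (rounding_step (Xb t) (Xb (Suc t)) x) real = c + d * real x"
    using rounding_step_mean by blast
  have "measure_pmf.expectation (rounded_schedule Xb (Suc t)) (\<lambda>X. real (X (Suc t)))
      = measure_pmf.expectation (rounded_schedule Xb t) (\<lambda>X. c + d * real (X t))"
    unfolding expectation_rounded_schedule_Suc fun_upd_same
    by (intro expectation_pmf_cong cd(2) rounded_schedule_roundings[of Xb, OF assms(1)]) auto
  also have "\<dots> = Xb (Suc t)"
    by (simp only: expectation_affine[OF finite_rounded_schedule] IH cd(1))
  finally show ?case .
qed

text \<open>\<open>expectation_roundings\<close> applied to the marginal law of the state at time
  \<open>t\<close>.\<close>

lemma expectation_operating_cost:
  assumes "Xb \<in> cont_schedules m t" "1 \<le> t"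
  shows "measure_pmf.expectation (rounded_schedule Xb t) (\<lambda>X. h (X t)) = interpolate m h (Xb t)"
proof -
  have "measure_pmf.expectation (map_pmf (\<lambda>X. X t) (rounded_schedule Xb t)) h
      = interpolate m h (Xb t)"
    using assms rounded_schedule_mean[of Xb t] rounded_schedule_roundings[of Xb]
    by (intro expectation_roundings) (auto simp: cont_schedules_def)
  then show ?thesis by simp
qed

text \<open>The direction of the move is the same for every outcome, so on the whole support the
  positive part is either the identity or zero and commutes with the expectation.\<close>

lemma expectation_switching_cost:
  assumes "Xb \<in> cont_schedules m (Suc t)"
  shows "measure_pmf.expectation (rounded_schedule Xb (Suc t))
           (\<lambda>X. max 0 (real (X (Suc t)) - real (X t)))
       = max 0 (Xb (Suc t) - Xb t)"
proof -
  let ?P = "rounded_schedule Xb (Suc t)"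
  have Xb: "Xb 0 = 0" "\<And>s. s \<in> {1..Suc t} \<Longrightarrow> 0 \<le> Xb s"
    using assms by (auto simp: cont_schedules_def)
  have step: "X t \<in> roundings (Xb t)
      \<and> X (Suc t) \<in> set_pmf (rounding_step (Xb t) (Xb (Suc t)) (X t))"
    if "X \<in> set_pmf ?P" for X
    using that rounded_schedule_roundings[of Xb, OF Xb(1), of _ t t] by auto
  have int: "integrable ?P (g :: _ \<Rightarrow> real)" for g
    by (intro integrable_measure_pmf_finite finite_rounded_schedule)
  \<comment> \<open>The mean at time \<open>t\<close> is unchanged under the longer law, since the
    last step does not touch coordinate \<open>t\<close>.\<close>
  have prev: "measure_pmf.expectation ?P (\<lambda>X. real (X t)) = Xb t"
    using rounded_schedule_mean[of Xb t] Xb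
    by (simp add: expectation_rounded_schedule_Suc del: rounded_schedule.simps)
  show ?thesis
  proof (cases "Xb t \<le> Xb (Suc t)")
    case True
    have "measure_pmf.expectation ?P (\<lambda>X. max 0 (real (X (Suc t)) - real (X t)))
        = measure_pmf.expectation ?P (\<lambda>X. real (X (Suc t)) - real (X t))"
      using rounding_step_up[OF True] step by (intro expectation_pmf_cong) fastforce
    also have "\<dots> = Xb (Suc t) - Xb t"
      using rounded_schedule_mean[of Xb "Suc t"] Xb prev
      by (simp add: Bochner_Integration.integral_diff[OF int int] del: rounded_schedule.simps)
    finally show ?thesis using True by simp
  next
    case False
    have "measure_pmf.expectation ?P (\<lambda>X. max 0 (real (X (Suc t)) - real (X t)))
        = measure_pmf.expectation ?P (\<lambda>X. 0)"
      using rounding_step_down[of "Xb (Suc t)" "Xb t"] False step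
      by (intro expectation_pmf_cong) fastforce
    then show ?thesis using False by simp
  qed
qed

section \<open>Expected total cost\<close>

lemma dc_cost_Suc:
  "dc_cost \<beta> (Suc t) f X
   = dc_cost \<beta> t f X + f (Suc t) (X (Suc t)) + \<beta> * max 0 (real (X (Suc t)) - real (X t))"
  by (simp add: dc_cost_def algebra_simps)

lemma dc_cost_upd: "dc_cost \<beta> t f (X(Suc t := x)) = dc_cost \<beta> t f X"
  unfolding dc_cost_def by (intro arg_cong2[where f = "(+)"] arg_cong2[where f = "(*)"] sum.cong) auto

lemma cont_cost_Suc:
  "cont_cost \<beta> (Suc t) g X
   = cont_cost \<beta> t g X + g (Suc t) (X (Suc t)) + \<beta> * max 0 (X (Suc t) - X t)"
  by (simp add: cont_cost_def algebra_simps)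

text \<open>Rounding costs nothing in expectation. By induction on the horizon, the cost up to
  \<open>t\<close> ignores the last coin, and the two new terms are the expected operating and
  switching costs of the last step.\<close>

lemma expectation_dc_cost:
  assumes "Xb \<in> cont_schedules m T"
  shows "measure_pmf.expectation (rounded_schedule Xb T) (dc_cost \<beta> T f)
       = cont_cost \<beta> T (\<lambda>t. interpolate m (f t)) Xb"
  using assms
proof (induction T)
  case 0
  then show ?case by (simp add: dc_cost_def cont_cost_def)
next
  case (Suc t)
  let ?P = "rounded_schedule Xb (Suc t)"
  have int: "integrable ?P (g :: _ \<Rightarrow> real)" for g
    by (intro integrable_measure_pmf_finite finite_rounded_schedule)
  have "Xb \<in> cont_schedules m t" using Suc.prems by (auto simp: cont_schedules_def)
  then have prev: "measure_pmf.expectation ?P (dc_cost \<beta> t f)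
      = cont_cost \<beta> t (\<lambda>t. interpolate m (f t)) Xb"
    using Suc.IH by (simp add: expectation_rounded_schedule_Suc dc_cost_upd del: rounded_schedule.simps)
  have "measure_pmf.expectation ?P (dc_cost \<beta> (Suc t) f)
      = measure_pmf.expectation ?P (dc_cost \<beta> t f)
        + measure_pmf.expectation ?P (\<lambda>X. f (Suc t) (X (Suc t)))
        + \<beta> * measure_pmf.expectation ?P (\<lambda>X. max 0 (real (X (Suc t)) - real (X t)))"
    unfolding dc_cost_Suc
    by (simp add: Bochner_Integration.integral_add[OF int int] del: rounded_schedule.simps)
  also have "\<dots> = cont_cost \<beta> (Suc t) (\<lambda>t. interpolate m (f t)) Xb"
    unfolding prev expectation_operating_cost[OF Suc.prems le_add1[of 1 t, unfolded plus_1_eq_Suc]]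
      expectation_switching_cost[OF Suc.prems] cont_cost_Suc ..
  finally show ?case .
qed

section \<open>Continuous versus discrete optimum\<close>

lemma interpolate_nonneg:
  assumes "\<And>x. x \<le> m \<Longrightarrow> 0 \<le> f x" "y \<in> {0..real m}"
  shows "0 \<le> interpolate m f y"
proof -
  define r where "r = y - of_int \<lfloor>y\<rfloor>"
  have "0 \<le> r" "r \<le> 1" unfolding r_def by linarith+
  moreover have "0 \<le> f (nat \<lfloor>y\<rfloor>)" "0 \<le> f (nat \<lceil>y\<rceil>)"
    using assms roundings_le[of _ y m] by (simp_all add: roundings_def)
  \<comment> \<open>The interpolated value rewritten as a convex combination of the values at the
    two neighbours.\<close>
  ultimately have "0 \<le> (1 - r) * f (nat \<lfloor>y\<rfloor>) + r * f (nat \<lceil>y\<rceil>)" by simp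
  then show ?thesis using assms(2) by (simp add: interpolate_def r_def algebra_simps)
qed

lemma cont_cost_nonneg:
  assumes "dc_instance m \<beta> T f" "X \<in> cont_schedules m T"
  shows "0 \<le> cont_cost \<beta> T (\<lambda>t. interpolate m (f t)) X"
  unfolding cont_cost_def using assms
  by (auto intro!: add_nonneg_nonneg sum_nonneg mult_nonneg_nonneg interpolate_nonneg
      simp: dc_instance_def cont_schedules_def simp del: atLeastAtMost_iff)

lemma cont_cost_of_nat:
  assumes "X \<in> dc_schedules m T"
  shows "cont_cost \<beta> T (\<lambda>t. interpolate m (f t)) (\<lambda>t. real (X t)) = dc_cost \<beta> T f X"
  using assms unfolding cont_cost_def dc_cost_def
  by (auto simp: dc_schedules_def interpolate_def intro!: sum.cong)

text \<open>Integral schedules are continuous schedules of the same cost, since the interpolation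
  agrees with \<open>f\<close> at integers. The continuous infimum thus ranges over more
  schedules.\<close>

lemma cont_opt_le_dc_opt:
  assumes "dc_instance m \<beta> T f"
  shows "cont_opt m \<beta> T (\<lambda>t. interpolate m (f t)) \<le> dc_opt m \<beta> T f"
  unfolding dc_opt_def
proof (rule cINF_greatest)
  show "dc_schedules m T \<noteq> {}" by (auto simp: dc_schedules_def intro!: exI[of _ "\<lambda>_. 0"])
next
  fix X assume X: "X \<in> dc_schedules m T"
  then have "(\<lambda>t. real (X t)) \<in> cont_schedules m T"
    by (simp add: dc_schedules_def cont_schedules_def)
  \<comment> \<open>A real-valued \<open>INF\<close> is a lower bound only for sets bounded below;
    nonnegativity of the cost supplies this.\<close>
  moreover have "bdd_below (cont_cost \<beta> T (\<lambda>t. interpolate m (f t)) ` cont_schedules m T)"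
    using cont_cost_nonneg[OF assms] by (intro bdd_belowI2)
  ultimately show "cont_opt m \<beta> T (\<lambda>t. interpolate m (f t)) \<le> dc_cost \<beta> T f X"
    unfolding cont_opt_def cont_cost_of_nat[OF X, symmetric] by (intro cINF_lower)
qed

theorem theorem4p4:
  fixes A :: cont_online_alg
  assumes "cont_competitive 2 A"
  shows "oblivious_competitive 2 (randomized_rounding A)"
  unfolding oblivious_competitive_def
proof (intro allI impI conjI)
  fix m \<beta> T f
  assume inst: "dc_instance m \<beta> T f"
  let ?g = "\<lambda>t. interpolate m (f t)"
  let ?X = "online_run A m \<beta> ?g"
  have X: "?X \<in> cont_schedules m T" and le: "cont_cost \<beta> T ?g ?X \<le> 2 * cont_opt m \<beta> T ?g"
    using assms inst by (auto simp: cont_competitive_def Let_def)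
  \<comment> \<open>Feasibility is inherited from the fractional run through the support
    invariant.\<close>
  show "set_pmf (randomized_rounding A m \<beta> f T) \<subseteq> dc_schedules m T"
  proof
    fix Y assume "Y \<in> set_pmf (randomized_rounding A m \<beta> f T)"
    then have Y: "Y s \<in> roundings (?X s)" if "s \<le> T" for s
      using rounded_schedule_roundings X that
      unfolding randomized_rounding_def cont_schedules_def by blast
    have "?X 0 = 0" using X by (simp add: cont_schedules_def)
    then have "Y 0 = 0" using Y[of 0] by (simp add: roundings_def)
    moreover have "Y t \<le> m" if "t \<in> {1..T}" for t
      using Y[of t] X that by (intro roundings_le[of "Y t" "?X t"]) (auto simp: cont_schedules_def)
    ultimately show "Y \<in> dc_schedules m T" by (simp add: dc_schedules_def)
  qed
  \<comment> \<open>The expected cost equals that of the fractional run, so the factor 2 comes from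
    \<open>A\<close> alone.\<close>
  show "measure_pmf.expectation (randomized_rounding A m \<beta> f T) (dc_cost \<beta> T f)
      \<le> 2 * dc_opt m \<beta> T f"
    unfolding randomized_rounding_def expectation_dc_cost[OF X]
    using le cont_opt_le_dc_opt[OF inst] by linarith
qed

end
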